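(* Let $f(t)=z(t)F(t)$ and $g(t)=z(t)G(t)$ be polynomials in $\mathbb{Z}[t]$, where $g(t)$ is monic and $z(t)$ is the monic greatest common divisor of $f(t)$ and $g(t)$. Let $r=\deg G(t)$ and assume $r\ge 1$. Let $Q(t)$ be the unique polynomial of degree less than $r$ such that $$Q(t)F(t)\equiv \operatorname{Res}(F,G)\bmod G(t).$$ Then (up to sign) $\gamma_{r-1}(f(C_g))=\operatorname{cont}(Q(t))$. In particular, $\gamma_{r-1}(f(C_g))=1$ if and only if $Q(t)$ is primitive.
   Context: For a monic polynomial $g(t)=t^n+\sum_{i=0}^{n-1}g_it^i\in \mathbb{Z}[t]$, the companion matrix $C_g\in \mathbb{Z}^{n\times n}$ has first row $(-g_{n-1},\dots,-g_1,-g_0)$, entries $1$ in positions $(i+1,i)$ for $1\le i\le n-1$, and $0$ elsewhere. For $f(t)=\sum_i f_it^i$, $f(C_g)=\sum_i f_iC_g^i$. For an $n\times n$ integer matrix $M$, $\gamma_0(M)=1$ and, for $1\le i\le n$, the $i$-th determinantal divisor $\gamma_i(M)$ is the GCD of all minors of $M$ of order $i$ (determinantal divisors, GCDs and resultants are taken up to sign). $\operatorname{Res}(F,G)=\prod_{\theta: G(\theta)=0}F(\theta)$ (complex roots with multiplicity; $G$ is monic). The content $\operatorname{cont}(Q)$ is the GCD of the coefficients of $Q$; $Q$ is primitive if its content is $\pm1$. *)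

theory Defs
  imports
    "Jordan_Normal_Form.Determinant"
    "Jordan_Normal_Form.DL_Submatrix"
    "HOL-Computational_Algebra.Computational_Algebra"
begin

(* Indices are 0-based, so column j of the first row holds -g_(n-1-j). *)
definition companion_matrix :: "int poly \<Rightarrow> int mat" where
  "companion_matrix g = (let n = degree g in
     mat n n (\<lambda>(i, j). if i = 0 then - coeff g (n - 1 - j)
                       else if i = j + 1 then 1 else 0))"

(* The sum of the matrices f_k * M^k, taken entrywise; M is meant to be square. *)
definition poly_matrix :: "int poly \<Rightarrow> int mat \<Rightarrow> int mat" where
  "poly_matrix f M = mat (dim_row M) (dim_row M)
     (\<lambda>(i, j). \<Sum>k\<le>degree f. coeff f k * (M ^\<^sub>m k) $$ (i, j))"

(* Gcd on int is nonnegative, which fixes the sign of the determinantal divisors. *)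
definition determinantal_divisor :: "nat \<Rightarrow> int mat \<Rightarrow> int" where
  "determinantal_divisor i M = (if i = 0 then 1 else
     Gcd {det (submatrix M I J) | I J.
            I \<subseteq> {..<dim_row M} \<and> J \<subseteq> {..<dim_col M} \<and> card I = i \<and> card J = i})"

(* Product of the values of F at the complex roots of G, with multiplicity; G is meant to be
   monic. The AFP constant resultant (a Sylvester determinant) takes the product over the roots
   of its first argument instead, and so differs from this one by the sign (-1)^(deg F * deg G). *)
definition Res :: "int poly \<Rightarrow> int poly \<Rightarrow> complex" where
  "Res F G = (\<Prod>\<theta> | poly (map_poly of_int G) \<theta> = 0.
                poly (map_poly of_int F) \<theta> ^ order \<theta> (map_poly of_int G))"

end

(* Multiplication by f on Z[t]/(g), in the basis t^(n-1), ..., t, 1 and acting on row vectors, has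
   matrix f(C_g). It factors as reduction modulo G, multiplication by F on Z[t]/(G), and
   multiplication by z; the outer two maps have one-sided inverses over Z, so f(C_g) and F(C_G)
   have the same determinantal divisors, by the divisibility half of the Cauchy-Binet formula.
   The minors of order r - 1 of F(C_G) are, up to sign, the entries of its adjugate. Over the
   complex numbers det F(C_G) is multiplicative in F and evaluates to Res(F, G), whence the
   adjugate is Q(C_G). The entries of Q(C_G) are integer combinations of the coefficients of Q, and
   its last row consists of exactly these coefficients. *)
theory Submission
  imports Defs "Jordan_Normal_Form.Char_Poly"
begin

section \<open>Minors of order k\<close>

text \<open>The index functions need not be monotone or injective: this only repeats minors up to sign or
  adds zeros, and it makes the property stable under products.\<close>

definition minors_dvd :: "'a::comm_ring_1 \<Rightarrow> nat \<Rightarrow> 'a mat \<Rightarrow> bool" where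
  "minors_dvd d k M \<longleftrightarrow> (\<forall>\<phi> \<psi>. (\<forall>i<k. \<phi> i < dim_row M) \<longrightarrow> (\<forall>j<k. \<psi> j < dim_col M) \<longrightarrow>
     d dvd det (mat k k (\<lambda>(i, j). M $$ (\<phi> i, \<psi> j))))"

lemma minors_dvdD:
  assumes "minors_dvd d k M" "\<And>i. i < k \<Longrightarrow> \<phi> i < dim_row M" "\<And>j. j < k \<Longrightarrow> \<psi> j < dim_col M"
  shows "d dvd det (mat k k (\<lambda>(i, j). M $$ (\<phi> i, \<psi> j)))"
  using assms unfolding minors_dvd_def by blast

lemma det_transpose_fun:
  "det (mat k k (\<lambda>(i, j). h j i)) = det (mat k k (\<lambda>(i, j). h i j))"
proof -
  have "mat k k (\<lambda>(i, j). h j i) = (mat k k (\<lambda>(i, j). h i j))\<^sup>T"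
    by (intro eq_matI) auto
  then show ?thesis
    using det_transpose[of "mat k k (\<lambda>(i, j). h i j)" k] by simp
qed

text \<open>Reindexing rows is left multiplication by the 0/1 matrix \<open>P\<close> whose row
  \<open>i\<close> has its one in column \<open>p i\<close>, so \<open>det P\<close> is the cofactor
  in the divisibility. It is a sign if \<open>p\<close> permutes the indices and 0
  otherwise.\<close>

lemma det_reindex_rows_dvd:
  fixes h :: "nat \<Rightarrow> nat \<Rightarrow> 'a::comm_ring_1"
  assumes "\<And>i. i < k \<Longrightarrow> p i < k"
  shows "det (mat k k (\<lambda>(i, j). h i j)) dvd det (mat k k (\<lambda>(i, j). h (p i) j))"
proof -
  define X where "X = mat k k (\<lambda>(i, j). h i j)"
  define P :: "'a mat" where "P = mat k k (\<lambda>(i, l). if l = p i then 1 else 0)"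
  have "mat k k (\<lambda>(i, j). h (p i) j) = P * X"
  proof (rule eq_matI)
    fix i j assume ij: "i < dim_row (P * X)" "j < dim_col (P * X)"
    then have "(P * X) $$ (i, j) = (\<Sum>l\<in>{0..<k}. (if l = p i then 1 else 0) * h l j)"
      by (simp add: P_def X_def scalar_prod_def)
    also have "\<dots> = (\<Sum>l\<in>{0..<k}. if l = p i then h l j else 0)"
      by (rule sum.cong) auto
    also have "\<dots> = h (p i) j"
      using assms ij by (subst sum.delta) (auto simp: P_def X_def)
    finally show "mat k k (\<lambda>(i, j). h (p i) j) $$ (i, j) = (P * X) $$ (i, j)"
      using ij by (simp add: P_def X_def)
  qed (auto simp: P_def X_def)
  then have "det (mat k k (\<lambda>(i, j). h (p i) j)) = det P * det X"
    using det_mult[of P k X] by (simp add: P_def X_def)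
  then show ?thesis by (simp add: X_def)
qed

lemma det_reindex_dvd:
  fixes h :: "nat \<Rightarrow> nat \<Rightarrow> 'a::comm_ring_1"
  assumes p: "\<And>i. i < k \<Longrightarrow> p i < k" and q: "\<And>j. j < k \<Longrightarrow> q j < k"
  shows "det (mat k k (\<lambda>(i, j). h i j)) dvd det (mat k k (\<lambda>(i, j). h (p i) (q j)))"
proof -
  have "det (mat k k (\<lambda>(i, j). h i j)) dvd det (mat k k (\<lambda>(i, j). h (p i) j))"
    using p by (rule det_reindex_rows_dvd)
  also have "det (mat k k (\<lambda>(i, j). h (p i) j)) = det (mat k k (\<lambda>(j, i). h (p i) j))"
    by (rule det_transpose_fun[symmetric])
  also have "\<dots> dvd det (mat k k (\<lambda>(j, i). h (p i) (q j)))"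
    using q by (rule det_reindex_rows_dvd)
  also have "\<dots> = det (mat k k (\<lambda>(i, j). h (p i) (q j)))"
    by (rule det_transpose_fun)
  finally show ?thesis .
qed

lemma det_not_inj_rows:
  fixes h :: "nat \<Rightarrow> nat \<Rightarrow> 'a::comm_ring_1"
  assumes "\<not> inj_on \<phi> {..<k}"
  shows "det (mat k k (\<lambda>(i, j). h (\<phi> i) j)) = 0"
proof -
  from assms obtain a b where ab: "a < k" "b < k" "a \<noteq> b" "\<phi> a = \<phi> b"
    by (auto simp: inj_on_def)
  show ?thesis
    by (rule det_identical_rows[OF _ ab(3,1,2)]) (use ab in \<open>auto simp: row_def\<close>)
qed

lemma minors_dvd_transpose:
  assumes "minors_dvd d k M"
  shows "minors_dvd d k M\<^sup>T"
  unfolding minors_dvd_def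
proof (intro allI impI)
  fix \<phi> \<psi>
  assume *: "\<forall>i<k. \<phi> i < dim_row M\<^sup>T" "\<forall>j<k. \<psi> j < dim_col M\<^sup>T"
  have "mat k k (\<lambda>(i, j). M\<^sup>T $$ (\<phi> i, \<psi> j)) = mat k k (\<lambda>(i, j). M $$ (\<psi> j, \<phi> i))"
    using * by (intro eq_matI) auto
  then have "det (mat k k (\<lambda>(i, j). M\<^sup>T $$ (\<phi> i, \<psi> j))) = det (mat k k (\<lambda>(i, j). M $$ (\<psi> i, \<phi> j)))"
    using det_transpose_fun[of k "\<lambda>i j. M $$ (\<psi> i, \<phi> j)"] by simp
  with minors_dvdD[OF assms, of \<psi> \<phi>] * show "d dvd det (mat k k (\<lambda>(i, j). M\<^sup>T $$ (\<phi> i, \<psi> j)))"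
    by simp
qed

text \<open>Each row of \<open>A * M\<close> is a linear combination of rows of \<open>M\<close>, so
  multilinearity of the determinant turns a minor of the product into a combination of determinants
  formed from rows of \<open>M\<close>. The rows chosen may repeat, which \<open>minors_dvd\<close>
  permits; hence no term has to be sorted or discarded.\<close>

lemma minors_dvd_mult_left:
  fixes A M :: "'a::comm_ring_1 mat"
  assumes A: "A \<in> carrier_mat n m" and M: "M \<in> carrier_mat m l" and d: "minors_dvd d k M"
  shows "minors_dvd d k (A * M)"
  unfolding minors_dvd_def
proof (intro allI impI)
  fix \<phi> \<psi>
  assume "\<forall>i<k. \<phi> i < dim_row (A * M)" "\<forall>j<k. \<psi> j < dim_col (A * M)"
  then have \<phi>: "\<phi> i < n" and \<psi>: "\<psi> i < l" if "i < k" for i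
    using A M that by auto
  \<comment> \<open>\<open>v x\<close> is row \<open>x\<close> of \<open>M\<close> restricted to the
    chosen columns, and \<open>a i x\<close> is its contribution to row \<open>i\<close> of the
    minor.\<close>
  define v where "v x = vec k (\<lambda>j. M $$ (x, \<psi> j))" for x
  define a where "a i x = A $$ (\<phi> i, x) \<cdot>\<^sub>v v x" for i x
  have v: "v x \<in> carrier_vec k" for x by (simp add: v_def)
  have a: "a i x \<in> carrier_vec k" for i x by (simp add: a_def v)
  have "mat k k (\<lambda>(i, j). (A * M) $$ (\<phi> i, \<psi> j))
        = mat\<^sub>r k k (\<lambda>i. finsum_vec TYPE('a) k (a i) {0..<m})"
  proof (rule eq_matI)
    fix i j assume "i < dim_row (mat\<^sub>r k k (\<lambda>i. finsum_vec TYPE('a) k (a i) {0..<m}))"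
      "j < dim_col (mat\<^sub>r k k (\<lambda>i. finsum_vec TYPE('a) k (a i) {0..<m}))"
    then have ij: "i < k" "j < k" by auto
    have "(A * M) $$ (\<phi> i, \<psi> j) = (\<Sum>x\<in>{0..<m}. A $$ (\<phi> i, x) * M $$ (x, \<psi> j))"
      using A M \<phi>[OF ij(1)] \<psi>[OF ij(2)] by (simp add: scalar_prod_def)
    also have "\<dots> = finsum_vec TYPE('a) k (a i) {0..<m} $ j"
      using ij a by (subst index_finsum_vec) (auto simp: a_def v_def)
    finally show "mat k k (\<lambda>(i, j). (A * M) $$ (\<phi> i, \<psi> j)) $$ (i, j)
        = mat\<^sub>r k k (\<lambda>i. finsum_vec TYPE('a) k (a i) {0..<m}) $$ (i, j)"
      using ij by simp
  qed auto
  \<comment> \<open>Being the identity outside \<open>{0..<k}\<close> makes each choice of rows a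
    unique function \<open>f\<close>, so the sum is finite.\<close>
  also have "det \<dots> = (\<Sum>f | (\<forall>i\<in>{0..<k}. f i \<in> {0..<m}) \<and> (\<forall>i. i \<notin> {0..<k} \<longrightarrow> f i = i).
      det (mat\<^sub>r k k (\<lambda>i. a i (f i))))"
    by (rule det_linear_rows_sum) (use a in auto)
  also have "d dvd \<dots>"
  proof (rule dvd_sum, clarify)
    fix f assume f: "\<forall>i\<in>{0..<k}. f i \<in> {0..<m}"
    have "mat\<^sub>r k k (\<lambda>i. v (f i)) = mat k k (\<lambda>(i, j). M $$ (f i, \<psi> j))"
      by (intro eq_matI) (auto simp: v_def)
    moreover have "d dvd det (mat k k (\<lambda>(i, j). M $$ (f i, \<psi> j)))"
      by (rule minors_dvdD[OF d]) (use f \<psi> M in auto)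
    moreover have "det (mat\<^sub>r k k (\<lambda>i. a i (f i))) = (\<Prod>i = 0..<k. A $$ (\<phi> i, f i)) * det (mat\<^sub>r k k (\<lambda>i. v (f i)))"
      unfolding a_def by (rule det_rows_mul) (use v in auto)
    ultimately show "d dvd det (mat\<^sub>r k k (\<lambda>i. a i (f i)))"
      by simp
  qed
  finally show "d dvd det (mat k k (\<lambda>(i, j). (A * M) $$ (\<phi> i, \<psi> j)))" .
qed

lemma minors_dvd_mult_right:
  fixes B M :: "'a::comm_ring_1 mat"
  assumes M: "M \<in> carrier_mat n m" and B: "B \<in> carrier_mat m l" and d: "minors_dvd d k M"
  shows "minors_dvd d k (M * B)"
proof -
  have "minors_dvd d k (B\<^sup>T * M\<^sup>T)"
    using M B by (intro minors_dvd_mult_left[OF _ _ minors_dvd_transpose[OF d]]) auto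
  then have "minors_dvd d k (B\<^sup>T * M\<^sup>T)\<^sup>T"
    by (rule minors_dvd_transpose)
  also have "(B\<^sup>T * M\<^sup>T)\<^sup>T = M * B"
    by (metis M B transpose_mult Matrix.transpose_transpose)
  finally show ?thesis .
qed

section \<open>Determinantal divisors described by their divisors\<close>

text \<open>Links the gcd over index sets to arbitrary index functions. A nonnegative integer is
  determined by its divisors, so determinantal divisors can afterwards be compared through
  \<open>minors_dvd\<close> alone.\<close>

lemma dvd_determinantal_divisor_iff:
  "d dvd determinantal_divisor k M \<longleftrightarrow> minors_dvd d k M"
proof (cases "k = 0")
  case True
  \<comment> \<open>The determinant of the empty matrix is 1, in agreement with the convention for
    order 0.\<close>
  then show ?thesis
    by (simp add: determinantal_divisor_def minors_dvd_def)
next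
  case False
  have sub: "submatrix M I J = mat k k (\<lambda>(i, j). M $$ (pick I i, pick J j))"
    if "I \<subseteq> {..<dim_row M}" "J \<subseteq> {..<dim_col M}" "card I = k" "card J = k" for I J
  proof -
    have "{i. i < dim_row M \<and> i \<in> I} = I" "{j. j < dim_col M \<and> j \<in> J} = J"
      using that by auto
    with that show ?thesis by (simp add: submatrix_def)
  qed
  have "minors_dvd d k M" if dvd: "d dvd determinantal_divisor k M"
    unfolding minors_dvd_def
  proof (intro allI impI)
    fix \<phi> \<psi>
    assume \<phi>: "\<forall>i<k. \<phi> i < dim_row M" and \<psi>: "\<forall>j<k. \<psi> j < dim_col M"
    show "d dvd det (mat k k (\<lambda>(i, j). M $$ (\<phi> i, \<psi> j)))"
    proof (cases "inj_on \<phi> {..<k} \<and> inj_on \<psi> {..<k}")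
      case False
      have "det (mat k k (\<lambda>(i, j). M $$ (\<phi> i, \<psi> j))) = 0"
      proof (cases "inj_on \<phi> {..<k}")
        case True
        with False have "\<not> inj_on \<psi> {..<k}" by simp
        then show ?thesis
          using det_not_inj_rows[of \<psi> k "\<lambda>j i. M $$ (\<phi> i, j)"]
            det_transpose_fun[of k "\<lambda>j i. M $$ (\<phi> i, \<psi> j)"] by simp
      qed (rule det_not_inj_rows)
      then show ?thesis by simp
    next
      case True
      define I where "I = \<phi> ` {..<k}"
      define J where "J = \<psi> ` {..<k}"
      \<comment> \<open>The rank of \<open>\<phi> i\<close> within \<open>I\<close>:
        \<open>pick I\<close> enumerates \<open>I\<close> increasingly, so
        \<open>pick I (p i) = \<phi> i\<close>, and the minor is a reindexing of a submatrix
        determinant.\<close>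
      define p where "p i = card {a \<in> I. a < \<phi> i}" for i
      define q where "q j = card {a \<in> J. a < \<psi> j}" for j
      have IJ: "I \<subseteq> {..<dim_row M}" "J \<subseteq> {..<dim_col M}" "card I = k" "card J = k"
        using \<phi> \<psi> True by (auto simp: I_def J_def card_image)
      have p: "p i < k" "pick I (p i) = \<phi> i" if "i < k" for i
      proof -
        have "\<phi> i \<in> I" using that by (simp add: I_def)
        then show "pick I (p i) = \<phi> i" by (simp add: p_def pick_card_in_set)
        have "{a \<in> I. a < \<phi> i} \<subset> I" using \<open>\<phi> i \<in> I\<close> by auto
        then show "p i < k"
          unfolding p_def IJ(3)[symmetric] by (intro psubset_card_mono) (simp_all add: I_def)
      qed
      have q: "q i < k" "pick J (q i) = \<psi> i" if "i < k" for i
      proof -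
        have "\<psi> i \<in> J" using that by (simp add: J_def)
        then show "pick J (q i) = \<psi> i" by (simp add: q_def pick_card_in_set)
        have "{a \<in> J. a < \<psi> i} \<subset> J" using \<open>\<psi> i \<in> J\<close> by auto
        then show "q i < k"
          unfolding q_def IJ(4)[symmetric] by (intro psubset_card_mono) (simp_all add: J_def)
      qed
      have "d dvd det (submatrix M I J)"
        using dvd \<open>k \<noteq> 0\<close> IJ
        by (auto simp: determinantal_divisor_def dvd_Gcd_iff)
      also have "\<dots> = det (mat k k (\<lambda>(i, j). M $$ (pick I i, pick J j)))"
        by (simp add: sub[OF IJ])
      also have "\<dots> dvd det (mat k k (\<lambda>(i, j). M $$ (pick I (p i), pick J (q j))))"
        by (rule det_reindex_dvd) (use p q in auto)
      also have "mat k k (\<lambda>(i, j). M $$ (pick I (p i), pick J (q j)))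
          = mat k k (\<lambda>(i, j). M $$ (\<phi> i, \<psi> j))"
        by (intro eq_matI) (auto simp: p q)
      finally show ?thesis .
    qed
  qed
  moreover have "d dvd determinantal_divisor k M" if dvd: "minors_dvd d k M"
  proof -
    have "d dvd det (submatrix M I J)"
      if IJ: "I \<subseteq> {..<dim_row M}" "J \<subseteq> {..<dim_col M}" "card I = k" "card J = k" for I J
      unfolding sub[OF IJ]
    proof (rule minors_dvdD[OF dvd])
      show "pick I i < dim_row M" if "i < k" for i
        using pick_in_set_le[of i I] that IJ by auto
      show "pick J j < dim_col M" if "j < k" for j
        using pick_in_set_le[of j J] that IJ by auto
    qed
    then show ?thesis
      using False by (auto simp: determinantal_divisor_def dvd_Gcd_iff)
  qed
  ultimately show ?thesis by blast
qed

section \<open>Minors of order \<open>n - 1\<close> and the adjugate\<close>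

text \<open>By counting, \<open>n - 1\<close> values cannot exhaust \<open>{0..<n}\<close>. If
  \<open>a\<close> is left out, \<open>\<phi>\<close> factors through \<open>insert_index a\<close>,
  the increasing enumeration of the remaining indices.\<close>

lemma missing_index:
  fixes \<phi> :: "nat \<Rightarrow> nat"
  assumes "\<And>i. i < n - 1 \<Longrightarrow> \<phi> i < n" "n > 0"
  obtains a p where "a < n" "\<forall>i<n - 1. p i < n - 1 \<and> insert_index a (p i) = \<phi> i"
proof -
  have "card (\<phi> ` {0..<n - 1}) \<le> n - 1"
    using card_image_le[of "{0..<n - 1}" \<phi>] by simp
  then have "\<not> {0..<n} \<subseteq> \<phi> ` {0..<n - 1}"
    using card_mono[of "\<phi> ` {0..<n - 1}" "{0..<n}"] assms(2) by auto
  then obtain a where a: "a < n" "a \<notin> \<phi> ` {0..<n - 1}"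
    by (meson atLeastLessThan_iff subsetI)
  have "\<exists>x. x < n - 1 \<and> insert_index a x = \<phi> i" if "i < n - 1" for i
  proof -
    have "\<phi> i \<in> {0..<n} - {a}" using that a assms by auto
    also have "{0..<n} - {a} = insert_index a ` {0..<n - 1}"
      using insert_index_image[of a "n - 1"] a(1) by simp
    finally show ?thesis by auto
  qed
  then have "\<forall>i. \<exists>x. i < n - 1 \<longrightarrow> x < n - 1 \<and> insert_index a x = \<phi> i" by blast
  then obtain p where "\<forall>i. i < n - 1 \<longrightarrow> p i < n - 1 \<and> insert_index a (p i) = \<phi> i"
    by (rule choice[THEN exE])
  with a(1) that show ?thesis by blast
qed

text \<open>Up to sign the entries of the adjugate are the determinants left after deleting one row
  and one column. Every other choice of \<open>n - 1\<close> rows and columns misses some row and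
  some column, and so is a reindexing of such a deletion.\<close>

lemma minors_dvd_iff_adj_mat:
  fixes N :: "'a::comm_ring_1 mat"
  assumes N: "N \<in> carrier_mat n n" and n: "n > 0"
  shows "minors_dvd d (n - 1) N \<longleftrightarrow> (\<forall>i<n. \<forall>j<n. d dvd adj_mat N $$ (i, j))"
proof -
  have unit: "d dvd (-1) ^ m * x \<longleftrightarrow> d dvd x" for m and x :: 'a
    by (cases "even m") auto
  have del: "mat_delete N a b = mat (n - 1) (n - 1) (\<lambda>(i, j). N $$ (insert_index a i, insert_index b j))"
    for a b
    using N by (intro eq_matI) (auto simp: mat_delete_def insert_index_def)
  have adj: "d dvd adj_mat N $$ (b, a) \<longleftrightarrow> d dvd det (mat_delete N a b)" if "a < n" "b < n" for a b
    using N that by (simp add: adj_mat_def cofactor_def unit)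
  have "minors_dvd d (n - 1) N \<longleftrightarrow> (\<forall>a<n. \<forall>b<n. d dvd det (mat_delete N a b))"
  proof (intro iffI allI impI)
    fix a b assume "minors_dvd d (n - 1) N" "a < n" "b < n"
    then show "d dvd det (mat_delete N a b)"
      unfolding del by (intro minors_dvdD) (use N in \<open>auto simp: insert_index_def\<close>)
  next
    assume *: "\<forall>a<n. \<forall>b<n. d dvd det (mat_delete N a b)"
    show "minors_dvd d (n - 1) N"
      unfolding minors_dvd_def
    proof (intro allI impI)
      fix \<phi> \<psi>
      assume "\<forall>i<n - 1. \<phi> i < dim_row N" "\<forall>j<n - 1. \<psi> j < dim_col N"
      then have \<phi>: "\<phi> i < n" and \<psi>: "\<psi> i < n" if "i < n - 1" for i
        using N that by auto
      obtain a p where a: "a < n" "\<forall>i<n - 1. p i < n - 1 \<and> insert_index a (p i) = \<phi> i"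
        using missing_index[of n \<phi>] \<phi> n by blast
      obtain b q where b: "b < n" "\<forall>i<n - 1. q i < n - 1 \<and> insert_index b (q i) = \<psi> i"
        using missing_index[of n \<psi>] \<psi> n by blast
      have "d dvd det (mat_delete N a b)" using * a(1) b(1) by blast
      also have "\<dots> dvd det (mat (n - 1) (n - 1) (\<lambda>(i, j). N $$ (insert_index a (p i), insert_index b (q j))))"
        unfolding del by (rule det_reindex_dvd) (use a b in auto)
      also have "mat (n - 1) (n - 1) (\<lambda>(i, j). N $$ (insert_index a (p i), insert_index b (q j)))
          = mat (n - 1) (n - 1) (\<lambda>(i, j). N $$ (\<phi> i, \<psi> j))"
        using a b by (intro eq_matI) auto
      finally show "d dvd det (mat (n - 1) (n - 1) (\<lambda>(i, j). N $$ (\<phi> i, \<psi> j)))" .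
    qed
  qed
  with adj show ?thesis by blast
qed

section \<open>Matrices of linear maps between polynomials\<close>

lemma dvd_degree_less_imp_0:
  fixes g :: "'a::idom poly"
  assumes "g dvd p" "p = 0 \<or> degree p < degree g"
  shows "p = 0"
  using assms dvd_imp_degree_le leD by blast

text \<open>Pseudo-division scales the dividend by a power of the leading coefficient, here 1. It is
  thus true division with remainder over any integral domain, which serves the integers and the
  complex numbers alike.\<close>

lemma monic_pseudo_divmod:
  fixes g :: "'a::idom poly"
  assumes "lead_coeff g = 1"
  shows "p = g * fst (pseudo_divmod p g) + pseudo_mod p g"
    and "pseudo_mod p g = 0 \<or> degree (pseudo_mod p g) < degree g"
proof -
  have "g \<noteq> 0" using assms by auto
  then show "p = g * fst (pseudo_divmod p g) + pseudo_mod p g"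
    and "pseudo_mod p g = 0 \<or> degree (pseudo_mod p g) < degree g"
    using pseudo_divmod[of g p "fst (pseudo_divmod p g)" "pseudo_mod p g"] assms
    by (auto simp: pseudo_mod_def)
qed

text \<open>Two remainders of \<open>p\<close> differ by a multiple of \<open>g\<close> of degree
  below that of \<open>g\<close>, which must be 0. Later identities between remainders are proved by
  this uniqueness.\<close>

lemma monic_pseudo_mod_eqI:
  fixes g :: "'a::idom poly"
  assumes g: "lead_coeff g = 1" and "g dvd p - s" "s = 0 \<or> degree s < degree g"
  shows "pseudo_mod p g = s"
proof -
  have "p - pseudo_mod p g = g * fst (pseudo_divmod p g)"
    using monic_pseudo_divmod(1)[OF g, of p] by (metis add_diff_cancel_right')
  then have "g dvd (p - s) - (p - pseudo_mod p g)"
    using assms(2) by (metis dvd_diff dvd_triv_left)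
  then have "g dvd pseudo_mod p g - s" by (simp add: algebra_simps)
  moreover have "pseudo_mod p g - s = 0 \<or> degree (pseudo_mod p g - s) < degree g"
    using monic_pseudo_divmod(2)[OF g, of p] assms(3)
    by (metis degree_diff_less diff_zero degree_minus diff_0)
  ultimately show ?thesis using dvd_degree_less_imp_0 by fastforce
qed

lemma monic_dvd_minus_pseudo_mod:
  fixes g :: "'a::idom poly"
  assumes "lead_coeff g = 1"
  shows "g dvd p - pseudo_mod p g"
  using monic_pseudo_divmod(1)[OF assms, of p] by (metis add_diff_cancel_right' dvd_triv_left)

lemma degree_pseudo_mod_less:
  fixes g :: "'a::idom poly"
  assumes "lead_coeff g = 1" "degree g > 0"
  shows "degree (pseudo_mod p g) < degree g"
  using monic_pseudo_divmod(2)[OF assms(1), of p] assms(2) by auto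

section \<open>Linear maps and their coefficient matrices\<close>

definition linear_poly :: "('a::comm_ring_1 poly \<Rightarrow> 'a poly) \<Rightarrow> bool" where
  "linear_poly L \<longleftrightarrow> (\<forall>p q. L (p + q) = L p + L q) \<and> (\<forall>c p. L (smult c p) = smult c (L p))"

text \<open>Sums and multiples of remainders are again remainders, so uniqueness applies. The
  multiplier \<open>f\<close> is built in; \<open>f = 1\<close> gives plain reduction.\<close>

lemma linear_poly_pseudo_mod:
  fixes g :: "'a::idom poly"
  assumes g: "lead_coeff g = 1"
  shows "linear_poly (\<lambda>p. pseudo_mod (p * f) g)"
  unfolding linear_poly_def
proof (intro conjI allI)
  note dvd = monic_dvd_minus_pseudo_mod[OF g] and deg = monic_pseudo_divmod(2)[OF g]
  fix p q :: "'a poly" and c :: 'a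
  have "g dvd (p * f - pseudo_mod (p * f) g) + (q * f - pseudo_mod (q * f) g)"
    using dvd by (intro dvd_add)
  then have "g dvd (p + q) * f - (pseudo_mod (p * f) g + pseudo_mod (q * f) g)"
    by (simp add: algebra_simps)
  then show "pseudo_mod ((p + q) * f) g = pseudo_mod (p * f) g + pseudo_mod (q * f) g"
    using deg[of "p * f"] deg[of "q * f"]
    by (intro monic_pseudo_mod_eqI[OF g]) (auto intro: degree_add_less)
  have "g dvd smult c (p * f - pseudo_mod (p * f) g)"
    using dvd by (rule dvd_smult)
  then have "g dvd smult c p * f - smult c (pseudo_mod (p * f) g)"
    by (simp add: smult_diff_right)
  then show "pseudo_mod (smult c p * f) g = smult c (pseudo_mod (p * f) g)"
    using deg[of "p * f"] by (intro monic_pseudo_mod_eqI[OF g]) auto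
qed

lemma linear_poly_expand:
  assumes L: "linear_poly L" and "degree p < r"
  shows "L p = (\<Sum>k<r. smult (coeff p k) (L (monom 1 k)))"
proof -
  have L0: "L 0 = 0" using L unfolding linear_poly_def by (metis smult_0_left)
  have Lsum: "L (\<Sum>k\<in>A. h k) = (\<Sum>k\<in>A. L (h k))" if "finite A" for A :: "nat set" and h
    using that by (induction A rule: finite_induct) (use L L0 in \<open>auto simp: linear_poly_def\<close>)
  have "p = (\<Sum>k\<le>r - 1. monom (coeff p k) k)"
    using assms by (intro poly_as_sum_of_monoms'[symmetric]) simp
  also have "\<dots> = (\<Sum>k<r. smult (coeff p k) (monom 1 k))"
    using assms by (intro sum.cong) (auto simp: smult_monom)
  finally have "L p = L (\<Sum>k<r. smult (coeff p k) (monom 1 k))" by simp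
  also have "\<dots> = (\<Sum>k<r. smult (coeff p k) (L (monom 1 k)))"
    using L by (subst Lsum) (auto simp: linear_poly_def)
  finally show ?thesis .
qed

text \<open>Row \<open>i\<close> holds the image of \<open>t ^ (m - 1 - i)\<close>, highest coefficient first, so a product of
  matrices is a composition of maps read from left to right.\<close>

definition lin_mat :: "nat \<Rightarrow> nat \<Rightarrow> ('a::comm_ring_1 poly \<Rightarrow> 'a poly) \<Rightarrow> 'a mat" where
  "lin_mat m n L = mat m n (\<lambda>(i, j). coeff (L (monom 1 (m - 1 - i))) (n - 1 - j))"

lemma lin_mat_carrier [simp]: "lin_mat m n L \<in> carrier_mat m n"
  by (simp add: lin_mat_def)

lemma lin_mat_dim [simp]: "dim_row (lin_mat m n L) = m" "dim_col (lin_mat m n L) = n"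
  by (simp_all add: lin_mat_def)

lemma lin_mat_index:
  "i < m \<Longrightarrow> j < n \<Longrightarrow> lin_mat m n L $$ (i, j) = coeff (L (monom 1 (m - 1 - i))) (n - 1 - j)"
  by (simp add: lin_mat_def)

lemma degree_monom_less: "0 < m \<Longrightarrow> k < m \<Longrightarrow> degree (monom c k) < m"
  using degree_monom_le[of c k] by linarith

lemma lin_mat_cong:
  assumes "\<And>p. degree p < m \<Longrightarrow> K p = L p"
  shows "lin_mat m n K = lin_mat m n L"
  by (intro eq_matI) (auto simp: lin_mat_index intro!: arg_cong2[of _ _ _ _ coeff] assms degree_monom_less)

text \<open>Application of \<open>L\<close> to a row vector of coefficients. It yields the product
  rule for these matrices, and later allows rows of the adjugate to be read as polynomials.\<close>

lemma lin_mat_vec: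
  assumes "linear_poly L" "degree p < r" "j < n"
  shows "(\<Sum>k<r. coeff p (r - 1 - k) * lin_mat r n L $$ (k, j)) = coeff (L p) (n - 1 - j)"
proof -
  have "coeff (L p) (n - 1 - j) = (\<Sum>k<r. coeff p k * coeff (L (monom 1 k)) (n - 1 - j))"
    by (subst linear_poly_expand[OF assms(1,2)]) (simp add: coeff_sum)
  also have "\<dots> = (\<Sum>k<r. coeff p (r - Suc k) * coeff (L (monom 1 (r - Suc k))) (n - 1 - j))"
    by (rule sum.nat_diff_reindex[symmetric])
  finally show ?thesis using assms(3) by (simp add: lin_mat_index)
qed

text \<open>The degree bound on \<open>K\<close> ensures that the \<open>r\<close> intermediate
  coordinates lose nothing of \<open>K p\<close>.\<close>

lemma lin_mat_mult:
  assumes "linear_poly L" "\<And>p. degree p < m \<Longrightarrow> degree (K p) < r"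
  shows "lin_mat m r K * lin_mat r n L = lin_mat m n (\<lambda>p. L (K p))"
proof (rule eq_matI)
  fix i j assume "i < dim_row (lin_mat m n (\<lambda>p. L (K p)))" "j < dim_col (lin_mat m n (\<lambda>p. L (K p)))"
  then have ij: "i < m" "j < n" by auto
  let ?p = "K (monom 1 (m - 1 - i))"
  have p: "degree ?p < r"
    using ij by (intro assms(2) degree_monom_less) auto
  have "(lin_mat m r K * lin_mat r n L) $$ (i, j)
      = (\<Sum>k<r. coeff ?p (r - 1 - k) * lin_mat r n L $$ (k, j))"
    using ij by (simp add: scalar_prod_def atLeast0LessThan lin_mat_index)
  also have "\<dots> = coeff (L ?p) (n - 1 - j)"
    by (rule lin_mat_vec[OF assms(1) p ij(2)])
  finally show "(lin_mat m r K * lin_mat r n L) $$ (i, j) = lin_mat m n (\<lambda>p. L (K p)) $$ (i, j)"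
    using ij by (simp add: lin_mat_index)
qed auto

lemma lin_mat_smult: "lin_mat n n (\<lambda>p. smult c p) = c \<cdot>\<^sub>m 1\<^sub>m n"
  by (intro eq_matI) (auto simp: lin_mat_index)

lemma lin_mat_id: "lin_mat n n (\<lambda>p. p) = 1\<^sub>m n"
  by (intro eq_matI) (auto simp: lin_mat_index)

section \<open>Multiplication modulo a monic polynomial\<close>

definition mult_mat :: "'a::idom poly \<Rightarrow> 'a poly \<Rightarrow> 'a mat" where
  "mult_mat g f = lin_mat (degree g) (degree g) (\<lambda>p. pseudo_mod (p * f) g)"

lemma mult_mat_carrier [simp]: "mult_mat g f \<in> carrier_mat (degree g) (degree g)"
  by (simp add: mult_mat_def)

lemma pseudo_mod_mult_left:
  fixes g :: "'a::idom poly"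
  assumes g: "lead_coeff g = 1"
  shows "pseudo_mod (pseudo_mod p g * f) g = pseudo_mod (p * f) g"
proof (rule monic_pseudo_mod_eqI[OF g])
  have "g dvd (p * f - pseudo_mod (p * f) g) - (p - pseudo_mod p g) * f"
    by (intro dvd_diff[OF _ dvd_mult2] monic_dvd_minus_pseudo_mod[OF g])
  then show "g dvd pseudo_mod p g * f - pseudo_mod (p * f) g"
    by (simp add: algebra_simps)
qed (rule monic_pseudo_divmod(2)[OF g])

text \<open>Reducing modulo \<open>g\<close> between the two multiplications does not change the
  final remainder, so the composite is multiplication by \<open>f * h\<close>.\<close>

lemma mult_mat_mult:
  fixes g :: "'a::idom poly"
  assumes "lead_coeff g = 1" "degree g > 0"
  shows "mult_mat g (f * h) = mult_mat g f * mult_mat g h"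
  unfolding mult_mat_def
  by (subst lin_mat_mult)
    (simp_all add: linear_poly_pseudo_mod degree_pseudo_mod_less assms pseudo_mod_mult_left mult.assoc)

lemma pseudo_mod_id:
  fixes g :: "'a::idom poly"
  assumes "lead_coeff g = 1" "degree p < degree g"
  shows "pseudo_mod p g = p"
  using assms by (intro monic_pseudo_mod_eqI) auto

lemma mult_mat_const:
  fixes g :: "'a::idom poly"
  assumes "lead_coeff g = 1"
  shows "mult_mat g [:c:] = c \<cdot>\<^sub>m 1\<^sub>m (degree g)"
  unfolding mult_mat_def lin_mat_smult[symmetric]
  by (rule lin_mat_cong) (use degree_smult_le le_less_trans in \<open>fastforce intro!: pseudo_mod_id assms\<close>)

text \<open>Multiplication by the variable shifts the monomial basis. Only the top monomial leaves
  the degree range; its remainder is \<open>monom 1 (degree g) - g\<close>, which gives the first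
  row.\<close>

lemma mult_mat_X:
  fixes g :: "'a::idom poly"
  assumes g: "lead_coeff g = 1"
  shows "mult_mat g [:0, 1:] = mat (degree g) (degree g)
    (\<lambda>(i, j). if i = 0 then - coeff g (degree g - 1 - j) else if i = j + 1 then 1 else 0)"
    (is "_ = mat ?n ?n ?h")
proof (rule eq_matI)
  fix i j assume "i < dim_row (mat ?n ?n ?h)" "j < dim_col (mat ?n ?n ?h)"
  then have ij: "i < ?n" "j < ?n" by auto
  have X: "monom 1 (?n - 1 - i) * [:0, 1:] = (monom 1 (?n - i) :: 'a poly)"
    using ij by (simp add: monom_Suc[symmetric] Suc_diff_Suc)
  have "mult_mat g [:0, 1:] $$ (i, j) = coeff (pseudo_mod (monom 1 (?n - i)) g) (?n - 1 - j)"
    unfolding mult_mat_def lin_mat_index[OF ij] X ..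
  also have "\<dots> = ?h (i, j)"
  proof (cases "i = 0")
    case True
    have "degree (monom 1 ?n - g) < ?n"
      using g ij by (intro degree_lessI) (auto simp: coeff_eq_0)
    then have "pseudo_mod (monom 1 ?n) g = monom 1 ?n - g"
      by (intro monic_pseudo_mod_eqI[OF g]) auto
    then show ?thesis using True ij by simp
  next
    case False
    then have "pseudo_mod (monom 1 (?n - i)) g = monom 1 (?n - i)"
      using ij by (intro pseudo_mod_id[OF g] degree_monom_less) auto
    then show ?thesis using False ij by auto
  qed
  finally show "mult_mat g [:0, 1:] $$ (i, j) = mat ?n ?n ?h $$ (i, j)"
    using ij by simp
qed (simp_all add: mult_mat_def)

text \<open>Powers of the companion matrix represent multiplication by powers of the variable,
  because \<open>mult_mat g\<close> is multiplicative; linearity extends this to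
  \<open>f\<close>.\<close>

lemma poly_matrix_companion:
  assumes g: "lead_coeff g = 1" "degree g > 0"
  shows "poly_matrix f (companion_matrix g) = mult_mat g f"
proof (rule eq_matI)
  let ?n = "degree g"
  have C: "companion_matrix g = mult_mat g [:0, 1:]"
    by (simp add: mult_mat_X[OF g(1)] companion_matrix_def Let_def)
  have dim: "dim_row (companion_matrix g) = ?n"
    by (simp add: companion_matrix_def Let_def)
  have pow: "companion_matrix g ^\<^sub>m k = mult_mat g (monom 1 k)" for k
  proof (induction k)
    case 0
    have "mult_mat g (monom 1 0) = 1\<^sub>m ?n"
      using mult_mat_const[OF g(1), of 1] by (auto simp: one_pCons)
    then show ?case by (simp add: C mult_mat_def)
  next
    case (Suc k)
    then show ?case
      by (simp add: C mult_mat_mult[OF g, symmetric] monom_Suc)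
  qed
  fix i j assume "i < dim_row (mult_mat g f)" "j < dim_col (mult_mat g f)"
  then have ij: "i < ?n" "j < ?n" by (auto simp: mult_mat_def)
  let ?t = "monom 1 (?n - 1 - i) :: int poly"
  have "poly_matrix f (companion_matrix g) $$ (i, j)
      = (\<Sum>k\<le>degree f. coeff f k * coeff (pseudo_mod (?t * monom 1 k) g) (?n - 1 - j))"
    using ij by (simp add: poly_matrix_def pow dim) (simp add: mult_mat_def lin_mat_index)
  \<comment> \<open>The factors are exchanged: the basis monomial \<open>?t\<close> becomes the
    fixed multiplier and \<open>f\<close> the argument to be expanded by linearity.\<close>
  also have "\<dots> = coeff (\<Sum>k<Suc (degree f). smult (coeff f k) (pseudo_mod (monom 1 k * ?t) g)) (?n - 1 - j)"
    by (simp add: coeff_sum lessThan_Suc_atMost mult.commute)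
  also have "\<dots> = coeff (pseudo_mod (f * ?t) g) (?n - 1 - j)"
    by (subst linear_poly_expand[OF linear_poly_pseudo_mod[OF g(1)], of f "Suc (degree f)"]) simp_all
  also have "\<dots> = mult_mat g f $$ (i, j)"
    using ij by (simp add: mult_mat_def lin_mat_index mult.commute)
  finally show "poly_matrix f (companion_matrix g) $$ (i, j) = mult_mat g f $$ (i, j)" .
qed (simp_all add: mult_mat_def poly_matrix_def companion_matrix_def Let_def)

section \<open>Determinant and resultant\<close>

text \<open>The image of a division identity over the integers is one over the larger ring, with the
  same degrees, so uniqueness of remainders applies.\<close>

lemma of_int_pseudo_mod:
  fixes g :: "int poly"
  assumes g: "lead_coeff g = 1"
  shows "map_poly (of_int :: int \<Rightarrow> 'a::{idom,ring_char_0}) (pseudo_mod p g)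
    = pseudo_mod (map_poly of_int p) (map_poly of_int g)"
proof (rule monic_pseudo_mod_eqI[symmetric])
  have "map_poly (of_int :: int \<Rightarrow> 'a) p
      = map_poly of_int (g * fst (pseudo_divmod p g) + pseudo_mod p g)"
    using monic_pseudo_divmod(1)[OF g, of p] by simp
  then have "map_poly (of_int :: int \<Rightarrow> 'a) p - map_poly of_int (pseudo_mod p g)
      = map_poly of_int g * map_poly of_int (fst (pseudo_divmod p g))"
    by (simp add: hom_distribs)
  then show "map_poly of_int g dvd map_poly (of_int :: int \<Rightarrow> 'a) p - map_poly of_int (pseudo_mod p g)"
    by simp
qed (use g monic_pseudo_divmod(2)[OF g, of p] in auto)

lemma of_int_mult_mat:
  fixes g :: "int poly"
  assumes g: "lead_coeff g = 1"
  shows "map_mat (of_int :: int \<Rightarrow> 'a::{idom,ring_char_0}) (mult_mat g f)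
    = mult_mat (map_poly of_int g) (map_poly of_int f)"
proof (rule eq_matI)
  fix i j
  assume "i < dim_row (mult_mat (map_poly (of_int :: int \<Rightarrow> 'a) g) (map_poly of_int f))"
    "j < dim_col (mult_mat (map_poly (of_int :: int \<Rightarrow> 'a) g) (map_poly of_int f))"
  then have ij: "i < degree g" "j < degree g" by (auto simp: mult_mat_def)
  let ?t = "monom 1 (degree g - 1 - i) :: int poly"
  have t: "map_poly (of_int :: int \<Rightarrow> 'a) ?t = monom 1 (degree g - 1 - i)"
    by (simp add: map_poly_monom)
  have "(of_int (coeff (pseudo_mod (?t * f) g) (degree g - 1 - j)) :: 'a)
      = coeff (map_poly of_int (pseudo_mod (?t * f) g)) (degree g - 1 - j)"
    by simp
  also have "\<dots> = coeff (pseudo_mod (monom 1 (degree g - 1 - i) * map_poly of_int f) (map_poly of_int g))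
      (degree g - 1 - j)"
    by (simp only: of_int_pseudo_mod[OF g] of_int_poly_hom.hom_mult t)
  finally show "map_mat of_int (mult_mat g f) $$ (i, j)
      = mult_mat (map_poly (of_int :: int \<Rightarrow> 'a) g) (map_poly of_int f) $$ (i, j)"
    using ij by (simp add: mult_mat_def lin_mat_index)
qed (simp_all add: mult_mat_def)

lemma det_mult_mat_mult:
  fixes g :: "'a::idom poly"
  assumes "lead_coeff g = 1" "degree g > 0"
  shows "det (mult_mat g (f * h)) = det (mult_mat g f) * det (mult_mat g h)"
  unfolding mult_mat_mult[OF assms] by (rule det_mult[OF mult_mat_carrier mult_mat_carrier])

lemma det_mult_mat_const:
  fixes g :: "'a::idom poly"
  assumes "lead_coeff g = 1"
  shows "det (mult_mat g [:c:]) = c ^ degree g"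
  by (simp add: mult_mat_const[OF assms] det_smult)

lemma det_mult_mat_prod:
  fixes g :: "'a::idom poly"
  assumes "lead_coeff g = 1" "degree g > 0" "finite A"
  shows "det (mult_mat g (\<Prod>x\<in>A. f x)) = (\<Prod>x\<in>A. det (mult_mat g (f x)))"
  using assms(3)
proof (induction A rule: finite_induct)
  case empty
  show ?case using det_mult_mat_const[OF assms(1), of 1] by (simp add: one_pCons)
qed (simp add: det_mult_mat_mult assms)

text \<open>Laplace expansion along the last column of the companion matrix, whose only possibly
  nonzero entry is \<open>- coeff g 0\<close> in the first row. Deleting that row and column leaves
  the identity.\<close>

lemma det_mult_mat_X:
  fixes g :: "'a::idom poly"
  assumes g: "lead_coeff g = 1" and n: "degree g > 0"
  shows "det (mult_mat g [:0, 1:]) = (-1) ^ degree g * coeff g 0"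
proof -
  let ?n = "degree g"
  define C where "C = mult_mat g [:0, 1:]"
  have C: "C \<in> carrier_mat ?n ?n" by (simp add: C_def)
  have idx: "C $$ (i, j) = (if i = 0 then - coeff g (?n - 1 - j) else if i = j + 1 then 1 else 0)"
    if "i < ?n" "j < ?n" for i j
    using that by (simp add: C_def mult_mat_X[OF g])
  have "mat_delete C 0 (?n - 1) = 1\<^sub>m (?n - 1)"
  proof (rule eq_matI)
    fix i j assume "i < dim_row (1\<^sub>m (?n - 1) :: 'a mat)" "j < dim_col (1\<^sub>m (?n - 1) :: 'a mat)"
    then show "mat_delete C 0 (?n - 1) $$ (i, j) = 1\<^sub>m (?n - 1) $$ (i, j)"
      using C idx[of "Suc i" j] by (auto simp: mat_delete_def)
  qed (use C in \<open>auto simp: mat_delete_def\<close>)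
  then have cof: "cofactor C 0 (?n - 1) = (-1) ^ (?n - 1)"
    by (simp add: cofactor_def)
  have "det C = (\<Sum>i<?n. C $$ (i, ?n - 1) * cofactor C i (?n - 1))"
    using n by (intro laplace_expansion_column[OF C]) simp
  also have "\<dots> = (\<Sum>i<?n. if i = 0 then - coeff g 0 * cofactor C 0 (?n - 1) else 0)"
    using n by (intro sum.cong) (auto simp: idx)
  also have "\<dots> = - coeff g 0 * (-1) ^ (?n - 1)"
    unfolding cof using n by simp
  also have "\<dots> = (-1) ^ ?n * coeff g 0"
    using n by (cases ?n) auto
  finally show ?thesis by (simp add: C_def)
qed

section \<open>Translation of the variable\<close>

lemma linear_poly_pcompose: "linear_poly (\<lambda>p. p \<circ>\<^sub>p s)"
  by (simp add: linear_poly_def pcompose_add pcompose_smult)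

lemma lead_coeff_pcompose_shift:
  fixes g :: "'a::idom poly"
  shows "lead_coeff (g \<circ>\<^sub>p [:a, 1:]) = lead_coeff g"
  using lead_coeff_comp[of "[:a, 1:]" g] by simp

text \<open>Substituting \<open>t + a\<close> for \<open>t\<close> is a change of basis; it reduces the factor \<open>t - a\<close> to
  \<open>t\<close>, whose matrix is the companion matrix.\<close>

lemma det_mult_mat_shift:
  fixes g :: "'a::idom poly"
  assumes g: "lead_coeff g = 1" and n: "degree g > 0"
  shows "det (mult_mat (g \<circ>\<^sub>p [:a, 1:]) (f \<circ>\<^sub>p [:a, 1:])) = det (mult_mat g f)"
proof -
  let ?n = "degree g"
  define s where "s = [:a, 1:]"
  define T where "T = lin_mat ?n ?n (\<lambda>p. p \<circ>\<^sub>p s)"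
  define T' where "T' = lin_mat ?n ?n (\<lambda>p. p \<circ>\<^sub>p [:-a, 1:])"
  have deg: "degree (p \<circ>\<^sub>p [:b, 1:]) = degree p" for p :: "'a poly" and b
    by simp
  have g': "lead_coeff (g \<circ>\<^sub>p s) = 1"
    unfolding s_def using g by (simp only: lead_coeff_pcompose_shift)
  have "[:-a, 1:] \<circ>\<^sub>p s = [:0, 1:]" by (simp add: s_def pcompose_pCons)
  then have inv: "(p \<circ>\<^sub>p [:-a, 1:]) \<circ>\<^sub>p s = p" for p
    by (simp add: pcompose_assoc[symmetric] pcompose_idR)
  have "T' * T = 1\<^sub>m ?n"
    unfolding T_def T'_def
    by (subst lin_mat_mult) (simp_all add: linear_poly_pcompose inv lin_mat_id)
  then have "det T' * det T = 1"
    using det_mult[of T' ?n T] by (simp add: T_def T'_def)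
  \<comment> \<open>Nonvanishing suffices here, since \<open>det T\<close> is only cancelled from a
    scalar equation at the end.\<close>
  then have T0: "det T \<noteq> 0" by auto
  \<comment> \<open>Substitution is a degree-preserving ring homomorphism, so it carries division by
    \<open>g\<close> to division by the shifted \<open>g\<close>.\<close>
  have shift: "pseudo_mod (p * f) g \<circ>\<^sub>p s = pseudo_mod ((p \<circ>\<^sub>p s) * (f \<circ>\<^sub>p s)) (g \<circ>\<^sub>p s)" for p
  proof (rule monic_pseudo_mod_eqI[OF g', symmetric])
    obtain q where "p * f - pseudo_mod (p * f) g = g * q"
      using monic_dvd_minus_pseudo_mod[OF g] by (rule dvdE)
    then have "(p * f - pseudo_mod (p * f) g) \<circ>\<^sub>p s = (g \<circ>\<^sub>p s) * (q \<circ>\<^sub>p s)"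
      by (simp add: pcompose_mult)
    then show "g \<circ>\<^sub>p s dvd (p \<circ>\<^sub>p s) * (f \<circ>\<^sub>p s) - pseudo_mod (p * f) g \<circ>\<^sub>p s"
      by (simp add: pcompose_mult pcompose_diff)
    show "pseudo_mod (p * f) g \<circ>\<^sub>p s = 0 \<or> degree (pseudo_mod (p * f) g \<circ>\<^sub>p s) < degree (g \<circ>\<^sub>p s)"
      using degree_pseudo_mod_less[OF g n] by (simp add: s_def)
  qed
  have "mult_mat g f * T = lin_mat ?n ?n (\<lambda>p. pseudo_mod (p * f) g \<circ>\<^sub>p s)"
    unfolding mult_mat_def T_def
    by (rule lin_mat_mult) (simp_all add: linear_poly_pcompose degree_pseudo_mod_less g n)
  also have "\<dots> = T * mult_mat (g \<circ>\<^sub>p s) (f \<circ>\<^sub>p s)"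
    unfolding shift unfolding mult_mat_def T_def s_def deg
    by (rule lin_mat_mult[OF linear_poly_pseudo_mod[OF g'[unfolded s_def]], symmetric]) simp
  finally have "det (mult_mat g f) * det T = det T * det (mult_mat (g \<circ>\<^sub>p s) (f \<circ>\<^sub>p s))"
    using det_mult[of "mult_mat g f" ?n T] det_mult[of T ?n "mult_mat (g \<circ>\<^sub>p s) (f \<circ>\<^sub>p s)"]
    by (simp add: T_def mult_mat_def s_def)
  with T0 show ?thesis by (simp add: s_def)
qed

lemma det_mult_mat_linear:
  fixes g :: "'a::idom poly"
  assumes g: "lead_coeff g = 1" "degree g > 0"
  shows "det (mult_mat g [:-a, 1:]) = (-1) ^ degree g * poly g a"
proof -
  have "det (mult_mat g [:-a, 1:]) = det (mult_mat (g \<circ>\<^sub>p [:a, 1:]) ([:-a, 1:] \<circ>\<^sub>p [:a, 1:]))"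
    by (rule det_mult_mat_shift[OF g, symmetric])
  also have "[:-a, 1:] \<circ>\<^sub>p [:a, 1:] = [:0, 1:]"
    by (simp add: pcompose_pCons)
  also have "det (mult_mat (g \<circ>\<^sub>p [:a, 1:]) [:0, 1:]) = (-1) ^ degree g * coeff (g \<circ>\<^sub>p [:a, 1:]) 0"
    using det_mult_mat_X[of "g \<circ>\<^sub>p [:a, 1:]", unfolded lead_coeff_pcompose_shift, OF g(1)] g(2) by simp
  also have "coeff (g \<circ>\<^sub>p [:a, 1:]) 0 = poly g a"
    by (simp add: poly_0_coeff_0[symmetric] poly_pcompose)
  finally show ?thesis .
qed

section \<open>Evaluation over the complex roots\<close>

lemma monic_complex_decompose:
  fixes g :: "complex poly"
  assumes "lead_coeff g = 1"
  shows "(\<Sum>\<theta> | poly g \<theta> = 0. order \<theta> g) = degree g"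
    and "poly g a = (\<Prod>\<theta> | poly g \<theta> = 0. (a - \<theta>) ^ order \<theta> g)"
proof -
  have g: "g = (\<Prod>\<theta> | poly g \<theta> = 0. [:- \<theta>, 1:] ^ order \<theta> g)"
    using complex_poly_decompose[of g] assms by simp
  have "degree g = (\<Sum>\<theta> | poly g \<theta> = 0. degree ([:- \<theta>, 1:] ^ order \<theta> g))"
    by (subst g, rule degree_prod_eq_sum_degree) auto
  then show "(\<Sum>\<theta> | poly g \<theta> = 0. order \<theta> g) = degree g"
    by (simp add: degree_power_eq)
  show "poly g a = (\<Prod>\<theta> | poly g \<theta> = 0. (a - \<theta>) ^ order \<theta> g)"
    by (subst g) (simp add: poly_prod)
qed

text \<open>Splitting \<open>f\<close> into linear factors reduces the determinant to values of
  \<open>g\<close> at the roots of \<open>f\<close>. Splitting \<open>g\<close> as well gives a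
  double product over both sets of roots, which is regrouped by the roots of
  \<open>g\<close>.\<close>

lemma det_mult_mat_complex:
  fixes f g :: "complex poly"
  assumes g: "lead_coeff g = 1" "degree g > 0"
  shows "det (mult_mat g f) = (\<Prod>\<theta> | poly g \<theta> = 0. poly f \<theta> ^ order \<theta> g)"
proof -
  obtain \<alpha> where f: "smult (lead_coeff f) (\<Prod>i<degree f. [:- \<alpha> i, 1:]) = f"
    by (rule complex_poly_decompose')
  \<comment> \<open>As the multiplicities add up to \<open>degree g\<close>, the leading coefficient
    and the sign can be distributed over the roots of \<open>g\<close>.\<close>
  have const: "(\<Prod>\<theta> | poly g \<theta> = 0. c ^ order \<theta> g) = c ^ degree g" for c :: complex
    by (simp add: power_sum[symmetric] monic_complex_decompose(1)[OF g(1)])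
  have lin: "(-1) ^ degree g * poly g a = (\<Prod>\<theta> | poly g \<theta> = 0. (\<theta> - a) ^ order \<theta> g)" for a
  proof -
    have "(-1) ^ degree g * poly g a
        = (\<Prod>\<theta> | poly g \<theta> = 0. (-1) ^ order \<theta> g * (a - \<theta>) ^ order \<theta> g)"
      by (simp only: prod.distrib const monic_complex_decompose(2)[OF g(1), of a])
    then show ?thesis by (simp add: power_mult_distrib[symmetric])
  qed
  have "det (mult_mat g f) = det (mult_mat g ([:lead_coeff f:] * (\<Prod>i<degree f. [:- \<alpha> i, 1:])))"
    by (subst (1) f[symmetric]) simp
  also have "\<dots> = lead_coeff f ^ degree g * (\<Prod>i<degree f. (-1) ^ degree g * poly g (\<alpha> i))"
    by (simp only: det_mult_mat_mult[OF g] det_mult_mat_const[OF g(1)] det_mult_mat_prod[OF g finite_lessThan]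
        det_mult_mat_linear[OF g])
  also have "\<dots> = (\<Prod>\<theta> | poly g \<theta> = 0. lead_coeff f ^ order \<theta> g) *
      (\<Prod>i<degree f. \<Prod>\<theta> | poly g \<theta> = 0. (\<theta> - \<alpha> i) ^ order \<theta> g)"
    by (simp only: const lin)
  also have "\<dots> = (\<Prod>\<theta> | poly g \<theta> = 0. (lead_coeff f * (\<Prod>i<degree f. \<theta> - \<alpha> i)) ^ order \<theta> g)"
    by (subst prod.swap) (simp add: prod.distrib power_mult_distrib prod_power_distrib)
  also have "\<dots> = (\<Prod>\<theta> | poly g \<theta> = 0. poly f \<theta> ^ order \<theta> g)"
    by (intro prod.cong refl arg_cong2[of _ _ _ _ "(^)"], subst (3) f[symmetric]) (simp add: poly_prod)
  finally show ?thesis .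
qed

text \<open>In particular, the complex number \<open>Res F G\<close> is an integer.\<close>

lemma det_mult_mat_eq_Res:
  assumes G: "lead_coeff G = 1" "degree G > 0"
  shows "of_int (det (mult_mat G F)) = Res F G"
proof -
  have "of_int (det (mult_mat G F)) = det (map_mat of_int (mult_mat G F) :: complex mat)"
    by simp
  also have "\<dots> = Res F G"
    unfolding of_int_mult_mat[OF G(1)] Res_def by (rule det_mult_mat_complex) (use G in simp_all)
  finally show ?thesis .
qed

section \<open>Adjugate and content\<close>

text \<open>Coprimality makes multiplication by \<open>F\<close> injective modulo \<open>G\<close>.
  This gives the uniqueness of \<open>Q\<close> and identifies the rows of the adjugate.\<close>

lemma dvd_mult_minus_unique:
  fixes G :: "int poly"
  assumes cop: "coprime F G"
    and "degree p < degree G" "degree q < degree G" "G dvd p * F - h" "G dvd q * F - h"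
  shows "p = q"
proof -
  have "G dvd (p * F - h) - (q * F - h)" using assms(4,5) by (rule dvd_diff)
  then have "G dvd (p - q) * F" by (simp add: algebra_simps)
  then have "G dvd p - q"
    using cop by (simp add: coprime_dvd_mult_left_iff coprime_commute)
  moreover have "degree (p - q) < degree G"
    using assms(2,3) by (rule degree_diff_less)
  ultimately show ?thesis using dvd_degree_less_imp_0[of G "p - q"] by simp
qed

text \<open>The identity \<open>adj_mat N * N = det N \<cdot>\<^sub>m 1\<^sub>m r\<close>, with
  \<open>r\<close> the degree of \<open>G\<close>, read one row at a time: a row of the adjugate is
  the coefficient vector of a solution of a congruence modulo \<open>G\<close>. The last row yields
  the existence of \<open>Q\<close> with integer coefficients.\<close>

lemma adj_mat_row_poly:
  fixes G :: "'a::idom poly"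
  assumes G: "lead_coeff G = 1" "degree G > 0" and i: "i < degree G"
  obtains p where "degree p < degree G"
    "\<And>j. j < degree G \<Longrightarrow> adj_mat (mult_mat G F) $$ (i, j) = coeff p (degree G - 1 - j)"
    "G dvd p * F - smult (det (mult_mat G F)) (monom 1 (degree G - 1 - i))"
proof -
  let ?r = "degree G"
  define N where "N = mult_mat G F"
  have N: "N \<in> carrier_mat ?r ?r" by (simp add: N_def)
  note adj = adj_mat[OF N]
  define p where "p = (\<Sum>k<?r. monom (adj_mat N $$ (i, ?r - 1 - k)) k)"
  have coeff_p: "coeff p m = (if m < ?r then adj_mat N $$ (i, ?r - 1 - m) else 0)" for m
    by (simp add: p_def coeff_sum)
  have deg: "degree p < ?r"
    using G(2) by (intro degree_lessI) (auto simp: coeff_p)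
  let ?h = "smult (det N) (monom 1 (?r - 1 - i))"
  have "pseudo_mod (p * F) G = ?h"
  proof (rule poly_eqI)
    fix m
    show "coeff (pseudo_mod (p * F) G) m = coeff ?h m"
    proof (cases "m < ?r")
      case True
      define j where "j = ?r - 1 - m"
      have j: "j < ?r" and m: "m = ?r - 1 - j" using True by (auto simp: j_def)
      have "coeff (pseudo_mod (p * F) G) m = (\<Sum>k<?r. coeff p (?r - 1 - k) * N $$ (k, j))"
        unfolding m N_def mult_mat_def
        by (rule lin_mat_vec[OF linear_poly_pseudo_mod[OF G(1)] deg j, symmetric])
      also have "\<dots> = (\<Sum>k<?r. adj_mat N $$ (i, k) * N $$ (k, j))"
        by (rule sum.cong) (auto simp: coeff_p)
      also have "\<dots> = (adj_mat N * N) $$ (i, j)"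
        using N adj(1) i j by (simp add: scalar_prod_def atLeast0LessThan)
      also have "\<dots> = coeff ?h m"
        using i j m by (auto simp: adj(3))
      finally show ?thesis .
    next
      case False
      then show ?thesis
        using degree_pseudo_mod_less[OF G, of "p * F"] i by (simp add: coeff_eq_0)
    qed
  qed
  then have "G dvd p * F - ?h"
    using monic_dvd_minus_pseudo_mod[OF G(1), of "p * F"] by simp
  moreover have "adj_mat (mult_mat G F) $$ (i, j) = coeff p (?r - 1 - j)" if "j < ?r" for j
    using that by (simp add: coeff_p N_def)
  ultimately show ?thesis using that deg by (simp add: N_def)
qed

text \<open>Row \<open>i\<close> of either side solves the same congruence, with right-hand side the
  determinant times the monomial of degree \<open>degree G - 1 - i\<close>; such solutions of degree
  below \<open>degree G\<close> are unique.\<close>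

lemma adj_mult_mat:
  fixes G :: "int poly"
  assumes G: "lead_coeff G = 1" "degree G > 0" and cop: "coprime F G"
    and Q: "G dvd Q * F - [:det (mult_mat G F):]"
  shows "adj_mat (mult_mat G F) = mult_mat G Q"
proof (rule eq_matI)
  let ?r = "degree G" and ?R = "det (mult_mat G F)"
  fix i j assume "i < dim_row (mult_mat G Q)" "j < dim_col (mult_mat G Q)"
  then have ij: "i < ?r" "j < ?r" by (auto simp: mult_mat_def)
  let ?t = "monom 1 (?r - 1 - i) :: int poly"
  obtain p where p: "degree p < ?r"
    "\<And>j. j < ?r \<Longrightarrow> adj_mat (mult_mat G F) $$ (i, j) = coeff p (?r - 1 - j)"
    "G dvd p * F - smult ?R ?t"
    using adj_mat_row_poly[OF G ij(1)] by metis
  have "G dvd ?t * (Q * F - [:?R:]) - (?t * Q - pseudo_mod (?t * Q) G) * F"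
    by (rule dvd_diff[OF dvd_mult[OF Q] dvd_mult2[OF monic_dvd_minus_pseudo_mod[OF G(1)]]])
  then have "G dvd pseudo_mod (?t * Q) G * F - smult ?R ?t"
    by (simp add: algebra_simps)
  then have "p = pseudo_mod (?t * Q) G"
    by (rule dvd_mult_minus_unique[OF cop p(1) degree_pseudo_mod_less[OF G] p(3)])
  then show "adj_mat (mult_mat G F) $$ (i, j) = mult_mat G Q $$ (i, j)"
    using ij by (subst p(2)[OF ij(2)]) (simp add: mult_mat_def lin_mat_index)
qed (use adj_mat(1)[OF mult_mat_carrier[of G F]] in \<open>auto simp: mult_mat_def\<close>)

text \<open>The last row represents the image of 1, which is \<open>Q\<close> itself because its
  degree is small enough. Conversely, a common factor of the coefficients of \<open>Q\<close> passes
  through every remainder by linearity.\<close>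

lemma dvd_mult_mat_iff:
  fixes G :: "int poly"
  assumes G: "lead_coeff G = 1" and Q: "degree Q < degree G"
  shows "(\<forall>i<degree G. \<forall>j<degree G. d dvd mult_mat G Q $$ (i, j)) \<longleftrightarrow> d dvd content Q"
proof -
  let ?r = "degree G"
  have "d dvd coeff Q m" if *: "\<forall>i<?r. \<forall>j<?r. d dvd mult_mat G Q $$ (i, j)" for m
  proof (cases "m < ?r")
    case True
    have "mult_mat G Q $$ (?r - 1, ?r - 1 - m) = coeff Q m"
      using True by (simp add: mult_mat_def lin_mat_index pseudo_mod_id[OF G Q])
    moreover have "d dvd mult_mat G Q $$ (?r - 1, ?r - 1 - m)" using * True by simp
    ultimately show ?thesis by simp
  next
    case False
    then show ?thesis using Q by (simp add: coeff_eq_0)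
  qed
  moreover have "d dvd mult_mat G Q $$ (i, j)"
    if d: "\<forall>m. d dvd coeff Q m" and ij: "i < ?r" "j < ?r" for i j
  proof -
    have "[:d:] dvd Q" using d by (simp add: const_poly_dvd_iff)
    then obtain q where q: "Q = smult d q" by (auto elim: dvdE)
    have "pseudo_mod (monom 1 (?r - 1 - i) * Q) G = smult d (pseudo_mod (monom 1 (?r - 1 - i) * q) G)"
      using linear_poly_pseudo_mod[OF G, of 1] by (simp add: q linear_poly_def)
    then show ?thesis using ij by (simp add: mult_mat_def lin_mat_index)
  qed
  ultimately have "(\<forall>i<?r. \<forall>j<?r. d dvd mult_mat G Q $$ (i, j)) \<longleftrightarrow> (\<forall>m. d dvd coeff Q m)"
    by blast
  also have "\<dots> \<longleftrightarrow> d dvd content Q"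
    by (simp add: const_poly_dvd_iff[symmetric] const_poly_dvd_iff_dvd_content)
  finally show ?thesis .
qed

section \<open>Removing the common factor\<close>

text \<open>Linearity of the remainder passes to \<open>z\<close> times the quotient, and
  \<open>z\<close> cancels. The quotient map thus has a matrix, which will undo multiplication by
  \<open>z\<close>.\<close>

lemma linear_poly_quot:
  fixes z :: "'a::idom poly"
  assumes z: "lead_coeff z = 1"
  shows "linear_poly (\<lambda>p. fst (pseudo_divmod p z))"
proof -
  have z0: "z \<noteq> 0" using z by auto
  have eq: "z * fst (pseudo_divmod p z) = p - pseudo_mod p z" for p
    using monic_pseudo_divmod(1)[OF z, of p] by (metis add_diff_cancel_right')
  have lin: "linear_poly (\<lambda>p. pseudo_mod p z)"
    using linear_poly_pseudo_mod[OF z, of 1] by simp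
  show ?thesis
    unfolding linear_poly_def
  proof (intro conjI allI)
    fix p q :: "'a poly" and c :: 'a
    have "z * fst (pseudo_divmod (p + q) z) = z * (fst (pseudo_divmod p z) + fst (pseudo_divmod q z))"
      using lin by (simp add: eq distrib_left linear_poly_def)
    then show "fst (pseudo_divmod (p + q) z) = fst (pseudo_divmod p z) + fst (pseudo_divmod q z)"
      using z0 by simp
    have "z * fst (pseudo_divmod (smult c p) z) = z * smult c (fst (pseudo_divmod p z))"
      using lin by (simp add: eq smult_diff_right linear_poly_def)
    then show "fst (pseudo_divmod (smult c p) z) = smult c (fst (pseudo_divmod p z))"
      using z0 by (metis mult_left_cancel)
  qed
qed

lemma quot_mult:
  fixes z :: "'a::idom poly"
  assumes z: "lead_coeff z = 1"
  shows "fst (pseudo_divmod (z * p) z) = p"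
proof -
  have "pseudo_mod (z * p) z = 0"
    by (rule monic_pseudo_mod_eqI[OF z]) auto
  then have "z * p = z * fst (pseudo_divmod (z * p) z)"
    using monic_pseudo_divmod(1)[OF z, of "z * p"] by simp
  moreover have "z \<noteq> 0" using z by auto
  ultimately show ?thesis by (metis mult_left_cancel)
qed

lemma minors_dvd_mult_mat_common_factor:
  fixes z :: "'a::idom poly"
  assumes z: "lead_coeff z = 1" and G: "lead_coeff G = 1" "degree G > 0"
  shows "minors_dvd d k (mult_mat (z * G) (z * F)) \<longleftrightarrow> minors_dvd d k (mult_mat G F)"
proof -
  let ?r = "degree G" and ?n = "degree (z * G)"
  have g: "lead_coeff (z * G) = 1" using z G(1) by (simp add: lead_coeff_mult)
  have z0: "z \<noteq> 0" and G0: "G \<noteq> 0" using z G(1) by auto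
  have n: "?n = degree z + ?r" using z0 G0 by (rule degree_mult_eq)
  have deg_z: "degree (z * p) < ?n" if "degree p < ?r" for p
    using degree_mult_le[of z p] that n by simp
  have pm: "pseudo_mod (p * (z * F)) (z * G) = z * pseudo_mod (p * F) G" for p
  proof (rule monic_pseudo_mod_eqI[OF g])
    have "z * G dvd z * (p * F - pseudo_mod (p * F) G)"
      using monic_dvd_minus_pseudo_mod[OF G(1)] by (rule mult_dvd_mono[OF dvd_refl])
    then show "z * G dvd p * (z * F) - z * pseudo_mod (p * F) G"
      by (simp add: algebra_simps)
    show "z * pseudo_mod (p * F) G = 0 \<or> degree (z * pseudo_mod (p * F) G) < ?n"
      using deg_z degree_pseudo_mod_less[OF G] by blast
  qed
  have lin_G: "linear_poly (\<lambda>p. pseudo_mod (p * F) G)"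
    by (rule linear_poly_pseudo_mod[OF G(1)])
  have lin_z: "linear_poly (\<lambda>p. z * p)"
    by (simp add: linear_poly_def distrib_left)
  \<comment> \<open>\<open>A\<close> reduces modulo \<open>G\<close> and \<open>B\<close> multiplies
    by \<open>z\<close>. \<open>A'\<close> includes the polynomials of degree below
    \<open>?r\<close>, on which reduction is the identity, and \<open>B'\<close> takes the quotient
    by \<open>z\<close>. Sandwiching by the first pair passes from \<open>F\<close>,
    \<open>G\<close> to \<open>z * F\<close>, \<open>z * G\<close>, by the second pair back.\<close>
  define A where "A = lin_mat ?n ?r (\<lambda>p. pseudo_mod p G)"
  define B where "B = lin_mat ?r ?n (\<lambda>p. z * p)"
  define A' where "A' = lin_mat ?r ?n (\<lambda>p. p :: 'a poly)"
  define B' where "B' = lin_mat ?n ?r (\<lambda>p. fst (pseudo_divmod p z))"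
  have "A * mult_mat G F = lin_mat ?n ?r (\<lambda>p. pseudo_mod (p * F) G)"
    unfolding A_def mult_mat_def
    by (subst lin_mat_mult[OF lin_G]) (simp_all add: degree_pseudo_mod_less[OF G] pseudo_mod_mult_left[OF G(1)])
  also have "\<dots> * B = mult_mat (z * G) (z * F)"
    unfolding B_def mult_mat_def pm
    by (subst lin_mat_mult[OF lin_z]) (simp_all add: degree_pseudo_mod_less[OF G])
  finally have M: "A * mult_mat G F * B = mult_mat (z * G) (z * F)" .
  have "A' * mult_mat (z * G) (z * F) = lin_mat ?r ?n (\<lambda>p. z * pseudo_mod (p * F) G)"
    unfolding A'_def mult_mat_def
    by (subst lin_mat_mult[OF linear_poly_pseudo_mod[OF g]]) (simp_all add: pm n)
  also have "\<dots> * B' = mult_mat G F"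
    unfolding B'_def mult_mat_def
    by (subst lin_mat_mult[OF linear_poly_quot[OF z]])
      (simp_all add: deg_z degree_pseudo_mod_less[OF G] quot_mult[OF z])
  finally have N: "A' * mult_mat (z * G) (z * F) * B' = mult_mat G F" .
  have carrier: "A \<in> carrier_mat ?n ?r" "B \<in> carrier_mat ?r ?n" "A' \<in> carrier_mat ?r ?n" "B' \<in> carrier_mat ?n ?r"
    by (simp_all add: A_def B_def A'_def B'_def)
  show ?thesis
  proof
    assume "minors_dvd d k (mult_mat (z * G) (z * F))"
    then have "minors_dvd d k (A' * mult_mat (z * G) (z * F))"
      by (rule minors_dvd_mult_left[OF carrier(3) mult_mat_carrier])
    then show "minors_dvd d k (mult_mat G F)"
      unfolding N[symmetric]
      by (rule minors_dvd_mult_right[OF mult_carrier_mat[OF carrier(3) mult_mat_carrier] carrier(4)])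
  next
    assume "minors_dvd d k (mult_mat G F)"
    then have "minors_dvd d k (A * mult_mat G F)"
      by (rule minors_dvd_mult_left[OF carrier(1) mult_mat_carrier])
    then show "minors_dvd d k (mult_mat (z * G) (z * F))"
      unfolding M[symmetric]
      by (rule minors_dvd_mult_right[OF mult_carrier_mat[OF carrier(1) mult_mat_carrier] carrier(2)])
  qed
qed

text \<open>The integer \<open>R\<close> expresses that the complex product \<open>Res F G\<close>
  is integral. The equality holds without a sign because \<open>Gcd\<close> and
  \<open>content\<close> are both normalized.\<close>

theorem corollary3p10:
  fixes f g z F G :: "int poly" and r :: nat
  assumes "f = z * F" and "g = z * G"
    and "lead_coeff g = 1"
    and "lead_coeff z = 1" and "z = gcd f g"
    and "r = degree G" and "r \<ge> 1"
  shows "\<exists>R :: int. of_int R = Res F G \<and>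
    (\<exists>!Q :: int poly. degree Q < r \<and> G dvd Q * F - [:R:]) \<and>
    (\<forall>Q :: int poly. degree Q < r \<and> G dvd Q * F - [:R:] \<longrightarrow>
       determinantal_divisor (r - 1) (poly_matrix f (companion_matrix g)) = content Q \<and>
       (determinantal_divisor (r - 1) (poly_matrix f (companion_matrix g)) = 1 \<longleftrightarrow>
        content Q = 1))"
proof -
  have z0: "z \<noteq> 0" using assms(4) by auto
  have G: "lead_coeff G = 1" "degree G > 0"
    using assms(2,3,4,6,7) by (auto simp: lead_coeff_mult)
  have "G \<noteq> 0" using G(1) by auto
  with z0 have "degree g = degree z + degree G"
    unfolding assms(2) by (rule degree_mult_eq)
  with assms(3) G(2) have g: "lead_coeff g = 1" "degree g > 0" by simp_all
  have "gcd f g = normalize (z * gcd F G)"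
    unfolding assms(1,2) by (rule gcd_mult_left)
  \<comment> \<open>The gcd of \<open>f\<close> and \<open>g\<close> is \<open>z\<close> times that
    of \<open>F\<close> and \<open>G\<close> up to a unit, and also equals \<open>z\<close>;
    cancelling \<open>z\<close> leaves a unit.\<close>
  then have "z * gcd F G dvd z * 1"
    using assms(5) by (metis dvd_normalize_iff dvd_refl mult.right_neutral normalize_dvd_iff)
  then have cop: "coprime F G"
    using z0 by (simp add: coprime_iff_gcd_eq_1 is_unit_gcd_iff)
  define R where "R = det (mult_mat G F)"
  have Res: "of_int R = Res F G"
    unfolding R_def by (rule det_mult_mat_eq_Res[OF G])
  \<comment> \<open>The last row of the adjugate: its monomial has exponent 0, so the right-hand
    side is the constant \<open>R\<close>.\<close>
  obtain q where q: "degree q < degree G"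
    "G dvd q * F - smult R (monom 1 (degree G - 1 - (degree G - 1)))"
    unfolding R_def using adj_mat_row_poly[OF G, of "degree G - 1" F] G(2) by auto
  have q': "G dvd q * F - [:R:]" using q(2) by (simp add: monom_0)
  have unique: "\<exists>!Q. degree Q < r \<and> G dvd Q * F - [:R:]"
    using q(1) q' dvd_mult_minus_unique[OF cop] unfolding assms(6) by blast
  have content: "determinantal_divisor (r - 1) (poly_matrix f (companion_matrix g)) = content Q"
    if Q: "degree Q < r" "G dvd Q * F - [:R:]" for Q
  proof (rule associated_eqI)
    let ?D = "determinantal_divisor (r - 1) (poly_matrix f (companion_matrix g))"
    have "d dvd ?D \<longleftrightarrow> d dvd content Q" for d
    proof -
      have "d dvd ?D \<longleftrightarrow> minors_dvd d (r - 1) (mult_mat g f)"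
        by (simp add: dvd_determinantal_divisor_iff poly_matrix_companion[OF g])
      also have "\<dots> \<longleftrightarrow> minors_dvd d (degree G - 1) (mult_mat G F)"
        unfolding assms(1,2,6) by (rule minors_dvd_mult_mat_common_factor[OF assms(4) G])
      also have "\<dots> \<longleftrightarrow> (\<forall>i<degree G. \<forall>j<degree G. d dvd mult_mat G Q $$ (i, j))"
        using adj_mult_mat[OF G cop] Q(2) G(2) by (subst minors_dvd_iff_adj_mat) (auto simp: R_def)
      also have "\<dots> \<longleftrightarrow> d dvd content Q"
        using Q(1) assms(6) by (intro dvd_mult_mat_iff[OF G(1)]) simp
      finally show ?thesis .
    qed
    then show "?D dvd content Q" "content Q dvd ?D" by (metis dvd_refl)+
    show "normalize ?D = ?D" by (simp add: determinantal_divisor_def)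
    show "normalize (content Q) = content Q" by (rule normalize_content)
  qed
  show ?thesis
  proof (intro exI[of _ R] conjI allI impI)
    fix Q assume "degree Q < r \<and> G dvd Q * F - [:R:]"
    then show "determinantal_divisor (r - 1) (poly_matrix f (companion_matrix g)) = content Q"
      "determinantal_divisor (r - 1) (poly_matrix f (companion_matrix g)) = 1 \<longleftrightarrow> content Q = 1"
      using content[of Q] by simp_all
  qed (fact Res unique)+
qed

end
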